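(* Let $d$ be a positive integer and let $M$ be a finitely generated $\mathbf{FI}_d$-module over a field $\mathbf{k}$. The Hilbert series $$\mathrm{H}_M(t)=\sum_{n\ge 0}\dim_{\mathbf{k}}M([n])\cdot t^n$$ is of the form $f(t)/g(t)$, where $f(t)$ and $g(t)$ are polynomials and $g(t)$ factors as $\prod_{j=1}^d(1-jt)^{e_j}$ with $e_j\ge 0$. In particular, if $d=1$ then $n\mapsto\dim_{\mathbf{k}}M([n])$ is eventually polynomial.
   Context: $[n]=\{1,\dots,n\}$. $\mathbf{FI}_d$ is the category whose objects are finite sets; a morphism $S\to T$ is a pair $(f,g)$ with $f\colon S\to T$ an injection and $g\colon T\setminus f(S)\to\{1,\dots,d\}$ a function. The composite of $(f,g)\colon S\to T$ and $(f',g')\colon T\to U$ is $(f'f,g'')$ where $g''=g'$ on $U\setminus f'(T)$ and $g''(f'(t))=g(t)$ for $t\in T\setminus f(S)$. An $\mathbf{FI}_d$-module over $\mathbf{k}$ is a functor $M$ from $\mathbf{FI}_d$ to $\mathbf{k}$-vector spaces; it is finitely generated if there is a finite set of elements (each in some $M(S)$) such that $M$ is the smallest submodule containing them. *)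

theory Defs
  imports
    "Jordan_Normal_Form.Missing_VectorSpace"
    "HOL-Computational_Algebra.Polynomial_FPS"
    "HOL-Library.FuncSet"
begin

section \<open>The category FI_d\<close>

text \<open>
  The objects are the finite sets of natural numbers. They form a full subcategory of the category
  with all finite sets as objects; it contains every \<open>[n] = {1..n}\<close>, and every finite set is
  isomorphic to one of its objects.

  A morphism \<open>S \<rightarrow> T\<close> is a pair of extensional functions, so that equality of pairs in a hom-set is
  equality of morphisms. The pair does not determine \<open>S\<close> and \<open>T\<close>; operations on morphisms
  therefore take source and target as arguments.
\<close>

type_synonym fid_mor = "(nat \<Rightarrow> nat) \<times> (nat \<Rightarrow> nat)"

definition fid_hom :: "nat \<Rightarrow> nat set \<Rightarrow> nat set \<Rightarrow> fid_mor set" where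
  "fid_hom d S T =
     {(f, g). f \<in> S \<rightarrow>\<^sub>E T \<and> inj_on f S \<and> g \<in> (T - f ` S) \<rightarrow>\<^sub>E {1..d}}"

definition fid_id :: "nat set \<Rightarrow> fid_mor" where
  "fid_id S = ((\<lambda>x\<in>S. x), (\<lambda>x. undefined))"

text \<open>\<open>fid_comp S T U \<psi> \<phi>\<close> is the composite of \<open>\<phi> : S \<rightarrow> T\<close> followed by \<open>\<psi> : T \<rightarrow> U\<close>.\<close>

definition fid_comp ::
  "nat set \<Rightarrow> nat set \<Rightarrow> nat set \<Rightarrow> fid_mor \<Rightarrow> fid_mor \<Rightarrow> fid_mor" where
  "fid_comp S T U \<psi> \<phi> =
     (let (f', g') = \<psi>; (f, g) = \<phi>
      in (compose S f' f,
          \<lambda>u \<in> U - (f' \<circ> f) ` S. if u \<in> f' ` T then g (inv_into T f' u) else g' u))"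

lemma fid_id_in_hom: "fid_id S \<in> fid_hom d S S"
  by (auto simp: fid_id_def fid_hom_def inj_on_def PiE_def extensional_def)

lemma fid_comp_in_hom:
  assumes "\<phi> \<in> fid_hom d S T" and "\<psi> \<in> fid_hom d T U"
  shows "fid_comp S T U \<psi> \<phi> \<in> fid_hom d S U"
proof -
  obtain f g where \<phi>: "\<phi> = (f, g)" by (cases \<phi>)
  obtain f' g' where \<psi>: "\<psi> = (f', g')" by (cases \<psi>)
  have f: "f \<in> S \<rightarrow>\<^sub>E T" "inj_on f S" and g: "g \<in> (T - f ` S) \<rightarrow>\<^sub>E {1..d}"
    using assms(1) by (auto simp: fid_hom_def \<phi>)
  have f': "f' \<in> T \<rightarrow>\<^sub>E U" "inj_on f' T" and g': "g' \<in> (U - f' ` T) \<rightarrow>\<^sub>E {1..d}"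
    using assms(2) by (auto simp: fid_hom_def \<psi>)
  have img: "compose S f' f ` S = (f' \<circ> f) ` S"
    by (auto simp: compose_def)
  have "inj_on f' (f ` S)"
    using f f' by (auto intro: inj_on_subset)
  then have "inj_on (compose S f' f) S"
    using f by (auto simp: inj_on_def compose_def)
  moreover have "compose S f' f \<in> S \<rightarrow>\<^sub>E U"
    using f f' by (auto simp: compose_def)
  moreover have "(if u \<in> f' ` T then g (inv_into T f' u) else g' u) \<in> {1..d}"
    if u: "u \<in> U - (f' \<circ> f) ` S" for u
  proof (cases "u \<in> f' ` T")
    case True
    then obtain t where t: "t \<in> T" "u = f' t" by auto
    then have "t \<in> T - f ` S" using u by auto
    then show ?thesis using t f' g by (auto simp: inv_into_f_f)
  next
    case False
    then show ?thesis using u g' by auto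
  qed
  ultimately show ?thesis
    by (auto simp: fid_comp_def fid_hom_def \<phi> \<psi> img simp del: comp_apply)
qed

lemma snd_fid_comp_outside:
  assumes "(f, g) \<in> fid_hom d S T" and "u \<in> U - f' ` T"
  shows "snd (fid_comp S T U (f', g') (f, g)) u = g' u"
  using assms by (auto simp: fid_comp_def fid_hom_def)

lemma snd_fid_comp_inside:
  assumes "(f, g) \<in> fid_hom d S T" and "(f', g') \<in> fid_hom d T U" and "t \<in> T - f ` S"
  shows "snd (fid_comp S T U (f', g') (f, g)) (f' t) = g t"
proof -
  have inj: "inj_on f' T" and f: "f ` S \<subseteq> T" and f': "f' ` T \<subseteq> U"
    using assms(1,2) by (auto simp: fid_hom_def)
  have "f' t \<notin> f' ` f ` S"
    using inj_on_image_mem_iff[OF inj] assms(3) f by blast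
  then show ?thesis
    using assms(3) inj f' by (auto simp: fid_comp_def inv_into_f_f image_comp)
qed


section \<open>Modules over FI_d\<close>

text \<open>
  A functor to \<open>K\<close>-vector spaces: \<open>M S\<close> is the value on \<open>S\<close>, and \<open>act S T \<phi>\<close> is the map induced by
  \<open>\<phi> : S \<rightarrow> T\<close>. Only its restriction to the carrier of \<open>M S\<close> is meaningful.
\<close>

locale fid_module =
  fixes d :: nat
    and K :: "('k, 'r) ring_scheme"
    and M :: "nat set \<Rightarrow> ('k, 'v, 'm) module_scheme"
    and act :: "nat set \<Rightarrow> nat set \<Rightarrow> fid_mor \<Rightarrow> 'v \<Rightarrow> 'v"
  assumes obj: "finite S \<Longrightarrow> vectorspace K (M S)"
    and mor: "\<lbrakk>finite S; finite T; \<phi> \<in> fid_hom d S T\<rbrakk>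
           \<Longrightarrow> linear_map K (M S) (M T) (act S T \<phi>)"
    and act_id: "\<lbrakk>finite S; x \<in> carrier (M S)\<rbrakk> \<Longrightarrow> act S S (fid_id S) x = x"
    and act_comp: "\<lbrakk>finite S; finite T; finite U;
             \<phi> \<in> fid_hom d S T; \<psi> \<in> fid_hom d T U; x \<in> carrier (M S)\<rbrakk>
           \<Longrightarrow> act S U (fid_comp S T U \<psi> \<phi>) x = act T U \<psi> (act S T \<phi> x)"
begin

definition fid_submodule :: "(nat set \<Rightarrow> 'v set) \<Rightarrow> bool" where
  "fid_submodule N \<longleftrightarrow>
     (\<forall>S. finite S \<longrightarrow> VectorSpace.subspace K (N S) (M S)) \<and>
     (\<forall>S T. \<forall>\<phi> \<in> fid_hom d S T. finite S \<longrightarrow> finite T \<longrightarrow> act S T \<phi> ` N S \<subseteq> N T)"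

definition finitely_generated :: bool where
  "finitely_generated \<longleftrightarrow>
     (\<exists>G :: (nat set \<times> 'v) set. finite G \<and>
        (\<forall>(S, x) \<in> G. finite S \<and> x \<in> carrier (M S)) \<and>
        (\<forall>N. fid_submodule N \<and> (\<forall>(S, x) \<in> G. x \<in> N S) \<longrightarrow>
             (\<forall>S. finite S \<longrightarrow> N S = carrier (M S))))"

text \<open>The library's \<^const>\<open>vectorspace.dim\<close> is a natural number and carries no information for
  infinite-dimensional spaces; the values of a finitely generated module are finite-dimensional.\<close>

definition hilbert_fun :: "nat \<Rightarrow> nat" where
  "hilbert_fun n = vectorspace.dim K (M {1..n})"

definition hilbert_series :: "rat fps" where
  "hilbert_series = Abs_fps (\<lambda>n. of_nat (hilbert_fun n))"

end

end

theory Submission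
  imports Defs "HOL-Library.Sublist" "HOL-Library.Infinite_Set" "HOL-Library.List_Lexorder"
begin

text \<open>
  A morphism \<open>S \<rightarrow> [n]\<close> is an enumeration of \<open>S\<close> together with a word of length \<open>n\<close> over
  \<open>{0..d}\<close>: the letter \<open>0\<close> marks the image of the injection, the other letters are the colours.
  So \<open>M([n])\<close> is spanned by vectors indexed by labelled words, finitely many labels for all \<open>n\<close>.
  Order the labelled words lexicographically and call one standard if its vector is not in the span
  of the vectors of smaller words of the same length; the standard words index a basis of
  \<open>M([n])\<close>. Inserting a fixed nonzero letter at a fixed position is the action of a morphism
  \<open>[n] \<rightarrow> [n + 1]\<close> and preserves the lexicographic order, so the language \<open>D\<close> of standard
  words with a given label is closed under deleting nonzero letters.

  The generating function of such a \<open>D\<close> is computed from the quotients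
  \<open>D\<^sub>a = {w. a w \<in> D}\<close>, as \<open>h(D) = [\<epsilon> \<in> D] + t (\<Sum>a. h(D\<^sub>a))\<close>. For \<open>a \<noteq> 0\<close> we have
  \<open>D\<^sub>a \<subseteq> D\<close>, while \<open>D\<^sub>0\<close> has fewer zeros. If \<open>k \<le> d\<close> of the \<open>D\<^sub>a\<close> are equal to \<open>D\<close>,
  this expresses \<open>(1 - k t) h(D)\<close> by the series of proper sublanguages and of \<open>D\<^sub>0\<close>; by Higman's lemma
  the recursion terminates.
\<close>

unbundle fps_syntax

section \<open>Higman's lemma\<close>

text \<open>Nash-Williams' argument. Among the sequences in which no word embeds in a later one,
  take one whose entries are successively as short as possible. Infinitely many entries share a
  first letter; removing it from them gives a bad sequence with a shorter entry.\<close>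

lemma higman:
  fixes w :: "nat \<Rightarrow> 'a list"
  assumes fin: "finite A" and w: "\<And>i. set (w i) \<subseteq> A"
  shows "\<exists>i j. i < j \<and> subseq (w i) (w j)"
proof (rule ccontr)
  assume neg: "\<not> ?thesis"
  define bad where
    "bad g \<longleftrightarrow> (\<forall>i. set (g i) \<subseteq> A) \<and> (\<forall>i j. i < j \<longrightarrow> \<not> subseq (g i) (g j))" for g :: "nat \<Rightarrow> 'a list"
  define P where
    "P n g \<longleftrightarrow> bad g \<and> (\<forall>h. bad h \<and> (\<forall>i<n. h i = g i) \<longrightarrow> length (g n) \<le> length (h n))" for n g
  have ex: "\<exists>g'. P n g' \<and> (\<forall>i<n. g' i = g i)" if "bad g" for g n
    using ex_has_least_nat[of "\<lambda>h. bad h \<and> (\<forall>i<n. h i = g i)" g "\<lambda>h. length (h n)"] that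
    unfolding P_def by auto
  have "bad w"
    using w neg by (auto simp: bad_def)
  \<comment> \<open>The diagonal of \<open>G\<close> is a minimal bad sequence.\<close>
  have "\<exists>G. \<forall>n. P n (G n) \<and> (\<forall>i<Suc n. G (Suc n) i = G n i)"
  proof (rule dependent_nat_choice)
    show "\<exists>g. P 0 g" using ex[OF \<open>bad w\<close>, of 0] by blast
  next
    fix g n assume "P n g"
    then have "bad g" by (simp add: P_def)
    then show "\<exists>g'. P (Suc n) g' \<and> (\<forall>i<Suc n. g' i = g i)" by (rule ex)
  qed
  then obtain G where P: "\<And>n. P n (G n)" and step: "\<And>n. \<forall>i<Suc n. G (Suc n) i = G n i"
    by blast
  define f where "f n = G n n" for n
  have agree: "G m i = f i" if "i \<le> m" for i m
    using that by (induction m rule: dec_induct) (auto simp: f_def step)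
  have bad_G: "bad (G n)" for n
    using P[of n] by (simp add: P_def)
  have letters: "set (f i) \<subseteq> A" for i
    using bad_G[of i] by (simp add: bad_def f_def)
  have not_subseq: "\<not> subseq (f i) (f j)" if "i < j" for i j
  proof -
    have "\<not> subseq (G j i) (G j j)"
      using bad_G[of j] that unfolding bad_def by blast
    then show ?thesis
      using agree[of i j] agree[of j j] that by simp
  qed
  have min: "length (f n) \<le> length (h n)" if "bad h" "\<forall>i<n. h i = f i" for h n
  proof -
    have "\<forall>i<n. h i = G n i" using that(2) agree[of _ n] by simp
    then show ?thesis using P[of n] that(1) unfolding P_def f_def by blast
  qed
  have ne: "f i \<noteq> []" for i
    using not_subseq[of i "Suc i"] by auto
  have "hd (f i) \<in> A" for i
    using letters[of i] hd_in_set[OF ne, of i] by blast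
  then have "range (\<lambda>i. hd (f i)) \<subseteq> A" by blast
  then obtain a where inf: "infinite {i. hd (f i) = a}"
    using pigeonhole_infinite[of UNIV "\<lambda>i. hd (f i)"] finite_subset[OF _ fin] by auto
  define \<phi> where "\<phi> = enumerate {i. hd (f i) = a}"
  have \<phi>: "hd (f (\<phi> i)) = a" for i
    using enumerate_in_set[OF inf] by (auto simp: \<phi>_def)
  have \<phi>_mono: "i < j \<Longrightarrow> \<phi> i < \<phi> j" for i j
    using enumerate_mono[OF _ inf] by (auto simp: \<phi>_def)
  have f\<phi>: "f (\<phi> i) = a # tl (f (\<phi> i))" for i
    using \<phi> ne by (metis list.collapse)
  \<comment> \<open>\<open>f\<close> before the index \<open>\<phi> 0\<close>, continued by the
    words that start with \<open>a\<close>, stripped of this letter. An embedding between entries of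
    \<open>h\<close> would give one between entries of \<open>f\<close>, by putting \<open>a\<close>
    back on the stripped words.\<close>
  define h where "h i = (if i < \<phi> 0 then f i else tl (f (\<phi> (i - \<phi> 0))))" for i
  have "bad h"
    unfolding bad_def
  proof (intro conjI allI impI)
    fix i show "set (h i) \<subseteq> A"
      using letters[of i] letters[of "\<phi> (i - \<phi> 0)"] list.set_sel(2)[OF ne]
      by (auto simp: h_def)
  next
    fix i j :: nat assume ij: "i < j"
    show "\<not> subseq (h i) (h j)"
    proof
      assume sub: "subseq (h i) (h j)"
      consider "j < \<phi> 0" | "i < \<phi> 0" "\<phi> 0 \<le> j" | "\<phi> 0 \<le> i"
        using ij by linarith
      then show False
      proof cases
        case 1
        then show ?thesis using sub ij not_subseq[OF ij] by (simp add: h_def)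
      next
        case 2
        have "\<phi> 0 \<le> \<phi> (j - \<phi> 0)"
          using \<phi>_mono[of 0 "j - \<phi> 0"] by (cases "j - \<phi> 0 = 0") auto
        moreover have "subseq (f i) (f (\<phi> (j - \<phi> 0)))"
          using sub 2 by (subst f\<phi>) (auto simp: h_def)
        ultimately show ?thesis
          using 2 not_subseq[of i "\<phi> (j - \<phi> 0)"] by simp
      next
        case 3
        then have "subseq (f (\<phi> (i - \<phi> 0))) (f (\<phi> (j - \<phi> 0)))"
          using sub ij by (subst (1 2) f\<phi>) (auto simp: h_def)
        moreover have "\<phi> (i - \<phi> 0) < \<phi> (j - \<phi> 0)"
          using 3 ij by (intro \<phi>_mono) auto
        ultimately show ?thesis using not_subseq by blast
      qed
    qed
  qed
  \<comment> \<open>\<open>h\<close> agrees with \<open>f\<close> below \<open>\<phi> 0\<close>, so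
    minimality applies at this index, where \<open>h\<close> is one letter shorter.\<close>
  then have "length (f (\<phi> 0)) \<le> length (h (\<phi> 0))"
    by (rule min) (simp add: h_def)
  then show False
    using ne[of "\<phi> 0"] by (cases "f (\<phi> 0)") (simp_all add: h_def)
qed

section \<open>Languages closed under deletion of nonzero letters\<close>

text \<open>Zeros mark the image of the injection, so their number \<open>m\<close> will be the size
  of the source. It is the same for all words; only colours may be deleted.\<close>

definition downset :: "nat \<Rightarrow> nat \<Rightarrow> nat list set \<Rightarrow> bool" where
  "downset d m D \<longleftrightarrow>
     (\<forall>w\<in>D. set w \<subseteq> {..d} \<and> count_list w 0 = m) \<and>
     (\<forall>u c v. u @ c # v \<in> D \<longrightarrow> c \<noteq> 0 \<longrightarrow> u @ v \<in> D)"

lemma downsetD: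
  assumes "downset d m D" "w \<in> D"
  shows "set w \<subseteq> {..d}" "count_list w 0 = m"
  using assms unfolding downset_def by blast+

lemma downset_delete:
  assumes "downset d m D" "u @ c # v \<in> D" "c \<noteq> 0"
  shows "u @ v \<in> D"
  using assms unfolding downset_def by blast

text \<open>As \<open>u\<close> and \<open>w\<close> have equally many zeros, the embedding skips
  only nonzero letters, which may be deleted. The prefix \<open>p\<close> collects the letters
  already matched in the induction.\<close>

lemma downset_subseq:
  assumes D: "downset d m D"
    and "subseq u w" "count_list u 0 = count_list w 0" "p @ w \<in> D"
  shows "p @ u \<in> D"
  using assms(2-)
proof (induction u w arbitrary: p rule: list_emb.induct)
  case (list_emb_Nil ys)
  then show ?case
  proof (induction ys)
    case (Cons y ys)
    then show ?case using downset_delete[OF D, of p y ys] by (auto split: if_splits)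
  qed auto
next
  case (list_emb_Cons xs ys y)
  have "count_list xs 0 \<le> count_list ys 0"
    using list_emb_Cons.hyps by (induction rule: list_emb.induct) auto
  then have "y \<noteq> 0" "count_list xs 0 = count_list ys 0"
    using list_emb_Cons.prems by (auto split: if_splits)
  moreover from this have "p @ ys \<in> D"
    using downset_delete[OF D, of p y ys] list_emb_Cons.prems by simp
  ultimately show ?case using list_emb_Cons.IH by blast
next
  case (list_emb_Cons2 x y xs ys)
  then show ?case using list_emb_Cons2.IH[of "p @ [y]"] by (auto split: if_splits)
qed

text \<open>In an infinite descending chain choose a word \<open>w i\<close> lost at each step. By
  Higman some \<open>w i\<close> embeds in a later \<open>w j\<close>, which lies in
  \<open>D (Suc i)\<close>. Both have \<open>m\<close> zeros, so \<open>w i\<close> lies there too,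
  a contradiction.\<close>

lemma wf_downset: "wf {(D', D). D' \<subset> D \<and> downset d m D' \<and> downset d m D}"
proof (rule ccontr)
  assume "\<not> ?thesis"
  then obtain D where "\<forall>i. (D (Suc i), D i) \<in> {(D', D). D' \<subset> D \<and> downset d m D' \<and> downset d m D}"
    unfolding wf_iff_no_infinite_down_chain by blast
  then have D: "\<And>i. D (Suc i) \<subset> D i" "\<And>i. downset d m (D i)"
    by auto
  have "\<forall>i. \<exists>w. w \<in> D i - D (Suc i)"
    using D(1) by blast
  then obtain w where w: "\<And>i. w i \<in> D i" "\<And>i. w i \<notin> D (Suc i)"
    by (metis DiffE)
  have "set (w i) \<subseteq> {..d}" "count_list (w i) 0 = m" for i
    using downsetD[OF D(2) w(1)] by auto
  moreover from this obtain i j where ij: "i < j" "subseq (w i) (w j)"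
    using higman[of "{..d}" w] by auto
  moreover have "D j \<subseteq> D (Suc i)"
    by (rule lift_Suc_antimono_le) (use D(1) ij(1) in \<open>auto simp: psubset_imp_subset\<close>)
  ultimately have "w i \<in> D (Suc i)"
    using downset_subseq[OF D(2), of "w i" "w j" "[]" "Suc i"] w(1)[of j] by auto
  then show False using w(2) by blast
qed

section \<open>Power series whose denominator is a product of factors 1 - j t\<close>

definition rational_gf :: "nat \<Rightarrow> rat fps \<Rightarrow> bool" where
  "rational_gf d F \<longleftrightarrow>
     (\<exists>f e. F * fps_of_poly (\<Prod>j = 1..d. [:1, - of_nat j:] ^ e j) = fps_of_poly f)"

lemma rational_gf_poly: "rational_gf d (fps_of_poly f)"
  unfolding rational_gf_def by (rule exI[of _ f], rule exI[of _ "\<lambda>_. 0"]) simp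

lemma rational_gf_mult_poly:
  assumes "rational_gf d F"
  shows "rational_gf d (fps_of_poly p * F)"
proof -
  obtain f e where "F * fps_of_poly (\<Prod>j = 1..d. [:1, - of_nat j:] ^ e j) = fps_of_poly f"
    using assms unfolding rational_gf_def by blast
  then have "fps_of_poly p * F * fps_of_poly (\<Prod>j = 1..d. [:1, - of_nat j:] ^ e j) = fps_of_poly (p * f)"
    by (simp only: mult.assoc fps_of_poly_mult)
  then show ?thesis
    unfolding rational_gf_def by blast
qed

lemma rational_gf_add:
  assumes "rational_gf d F" "rational_gf d G"
  shows "rational_gf d (F + G)"
proof -
  let ?Q = "\<lambda>e. \<Prod>j = 1..d. [:1, - of_nat j:] ^ e j :: rat poly"
  obtain f e g e' where *: "F * fps_of_poly (?Q e) = fps_of_poly f"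
      "G * fps_of_poly (?Q e') = fps_of_poly g"
    using assms unfolding rational_gf_def by blast
  have Q: "?Q (\<lambda>j. e j + e' j) = ?Q e * ?Q e'"
    by (simp add: power_add prod.distrib)
  have "(F + G) * fps_of_poly (?Q (\<lambda>j. e j + e' j)) =
      F * fps_of_poly (?Q e) * fps_of_poly (?Q e') + G * fps_of_poly (?Q e') * fps_of_poly (?Q e)"
    unfolding Q by (simp only: fps_of_poly_mult algebra_simps)
  also have "\<dots> = fps_of_poly (f * ?Q e' + g * ?Q e)"
    by (simp only: * fps_of_poly_mult fps_of_poly_add)
  finally show ?thesis
    unfolding rational_gf_def
    by (intro exI[of _ "f * ?Q e' + g * ?Q e"] exI[of _ "\<lambda>j. e j + e' j"])
qed

lemma rational_gf_sum: "(\<And>x. x \<in> I \<Longrightarrow> rational_gf d (F x)) \<Longrightarrow> rational_gf d (\<Sum>x\<in>I. F x)"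
  using rational_gf_poly[of d 0] by (induction I rule: infinite_finite_induct) (auto intro: rational_gf_add)

text \<open>The factor 1 - k t is one of those allowed in the denominator and is absorbed by raising
  its exponent by one. For \<open>k = 0\<close> it is 1.\<close>

lemma rational_gf_divide:
  assumes "rational_gf d (fps_of_poly [:1, - of_nat k:] * F)" "k \<le> d"
  shows "rational_gf d F"
proof (cases "k = 0")
  case False
  let ?Q = "\<lambda>e. \<Prod>j = 1..d. [:1, - of_nat j:] ^ e j :: rat poly"
  obtain f e where *: "fps_of_poly [:1, - of_nat k:] * F * fps_of_poly (?Q e) = fps_of_poly f"
    using assms unfolding rational_gf_def by blast
  have k: "k \<in> {1..d}" using False assms by auto
  have "?Q (e(k := Suc (e k))) = [:1, - of_nat k:] * ?Q e"
    using k by (simp add: prod.remove[OF _ k] del: mult_pCons_left mult_pCons_right One_nat_def)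
  then have "F * fps_of_poly (?Q (e(k := Suc (e k)))) = fps_of_poly f"
    using * by (simp only: fps_of_poly_mult ac_simps)
  then show ?thesis
    unfolding rational_gf_def by blast
qed (use assms in simp)

definition lang_gf :: "'a list set \<Rightarrow> rat fps" where
  "lang_gf D = Abs_fps (\<lambda>n. of_nat (card {w \<in> D. length w = n}))"

text \<open>A nonempty word is a first letter followed by a word of the corresponding quotient; the
  factor \<open>[:0, 1:]\<close>, that is t, accounts for the letter.\<close>

lemma lang_gf_split:
  assumes fin: "finite A" and D: "\<And>w. w \<in> D \<Longrightarrow> set w \<subseteq> A"
  shows "lang_gf D = fps_of_poly [:if [] \<in> D then 1 else 0:]
           + fps_of_poly [:0, 1:] * (\<Sum>a\<in>A. lang_gf {w. a # w \<in> D})"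
proof (rule fps_ext)
  fix n
  show "lang_gf D $ n = (fps_of_poly [:if [] \<in> D then 1 else 0:]
           + fps_of_poly [:0, 1:] * (\<Sum>a\<in>A. lang_gf {w. a # w \<in> D})) $ n"
  proof (cases n)
    case 0
    have "{w \<in> D. w = []} = (if [] \<in> D then {[]} else {})" by auto
    then show ?thesis by (simp add: 0 lang_gf_def)
  next
    case (Suc k)
    have "{w \<in> D. length w = Suc k} = (\<Union>a\<in>A. (#) a ` {w. a # w \<in> D \<and> length w = k})"
      using D by (force simp: length_Suc_conv)
    moreover have "finite {w. a # w \<in> D \<and> length w = k}" for a
      by (rule finite_subset[OF _ finite_lists_length_eq[OF fin, of k]]) (use D in force)
    ultimately have "card {w \<in> D. length w = Suc k} = (\<Sum>a\<in>A. card {w. a # w \<in> D \<and> length w = k})"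
      by (simp, subst card_UN_disjoint) (auto simp: fin card_image)
    then show ?thesis
      by (simp add: Suc lang_gf_def fps_sum_nth fps_of_poly_pCons coeff_pCons)
  qed
qed

text \<open>Two nested inductions: the outer one on \<open>m\<close> handles the quotient by 0,
  whose words have one zero fewer; the inner one, on \<open>D\<close> under strict inclusion,
  handles the quotients by nonzero letters that are smaller than \<open>D\<close>.\<close>

theorem rational_lang_gf: "downset d m D \<Longrightarrow> rational_gf d (lang_gf D)"
proof (induction m arbitrary: D rule: less_induct)
  case (less m)
  show ?case
    using less.prems
  proof (induction D rule: wf_induct_rule[OF wf_downset[of d m]])
    case (1 D)
    let ?q = "\<lambda>a. {w. a # w \<in> D}"
    note letters = downsetD[OF \<open>downset d m D\<close>] and del = downset_delete[OF \<open>downset d m D\<close>]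
    \<comment> \<open>For \<open>m = 0\<close> the truncated \<open>m - 1\<close> is harmless: no
      word of \<open>D\<close> contains 0, so the quotient by 0 is empty.\<close>
    have q_down: "downset d (if a = 0 then m - 1 else m) (?q a)" for a
      unfolding downset_def
    proof (intro conjI ballI allI impI)
      fix w assume "w \<in> ?q a"
      then show "set w \<subseteq> {..d}" "count_list w 0 = (if a = 0 then m - 1 else m)"
        using letters[of "a # w"] by auto
    next
      fix u c v assume "u @ c # v \<in> ?q a" "c \<noteq> 0"
      then show "u @ v \<in> ?q a"
        using del[of "a # u" c v] by auto
    qed
    have q_sub: "?q a \<subseteq> D" if "a \<noteq> 0" for a
    proof
      fix w assume "w \<in> ?q a"
      then show "w \<in> D" using del[of "[]" a w] that by simp
    qed
    \<comment> \<open>No induction hypothesis covers these quotients; they move to the left-hand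
      side. As 0 is excluded, \<open>card E \<le> d\<close>, so the factor that arises is an allowed
      one.\<close>
    define E where "E = {a \<in> {1..d}. ?q a = D}"
    have "E \<subseteq> {1..d}"
      by (auto simp: E_def)
    then have E: "card E \<le> d" "finite E"
      using card_mono[of "{1..d}" E] finite_subset[of E "{1..d}"] by auto
    have "rational_gf d (lang_gf (?q a))" if "a \<in> {..d} - E" for a
    proof (cases "a = 0")
      case True
      show ?thesis
      proof (cases "m = 0")
        case True
        have "a # w \<notin> D" for w
          using True \<open>a = 0\<close> letters(2)[of "a # w"] by auto
        then have "?q a = {}"
          by simp
        then have "lang_gf (?q a) = 0"
          by (simp add: lang_gf_def fps_eq_iff)
        then show ?thesis
          using rational_gf_poly[of d 0] by simp
      next
        case False
        then show ?thesis
          using less.IH[of "m - 1"] q_down[of a] \<open>a = 0\<close> by simp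
      qed
    next
      case False
      then have "?q a \<subset> D"
        using q_sub[OF False] by (intro psubsetI) (use that False in \<open>simp_all add: E_def\<close>)
      moreover have "downset d m (?q a)"
        using q_down[of a] False by simp
      ultimately show ?thesis
        using \<open>downset d m D\<close> by (intro "1.IH") blast+
    qed
    then have rest: "rational_gf d (fps_of_poly [:if [] \<in> D then 1 else 0:]
        + fps_of_poly [:0, 1:] * (\<Sum>a\<in>{..d} - E. lang_gf (?q a)))"
      by (intro rational_gf_add rational_gf_poly rational_gf_mult_poly rational_gf_sum)
    have "lang_gf D = fps_of_poly [:if [] \<in> D then 1 else 0:]
        + fps_of_poly [:0, 1:] * (\<Sum>a\<le>d. lang_gf (?q a))"
      by (rule lang_gf_split[OF finite_atMost letters(1)])
    also have "(\<Sum>a\<le>d. lang_gf (?q a)) = (\<Sum>a\<in>{..d} - E. lang_gf (?q a)) + (\<Sum>a\<in>E. lang_gf (?q a))"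
      by (subst sum.subset_diff[of E]) (auto simp: E_def)
    also have "(\<Sum>a\<in>E. lang_gf (?q a)) = of_nat (card E) * lang_gf D"
      by (simp add: E_def)
    finally have *: "lang_gf D = fps_of_poly [:if [] \<in> D then 1 else 0:]
        + fps_of_poly [:0, 1:] * ((\<Sum>a\<in>{..d} - E. lang_gf (?q a)) + of_nat (card E) * lang_gf D)" .
    have solve: "(1 - X * k) * H = C + X * R" if "H = C + X * (R + k * H)" for X k H C R :: "rat fps"
    proof -
      have "C + X * R = (C + X * (R + k * H)) - X * k * H"
        by (simp add: algebra_simps)
      also have "\<dots> = H - X * k * H"
        by (simp only: that[symmetric])
      finally show ?thesis
        by (simp add: algebra_simps)
    qed
    have "fps_of_poly [:1, - of_nat (card E):] = (1 - fps_of_poly [:0, 1:] * of_nat (card E) :: rat fps)"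
      by (simp add: fps_of_poly_pCons fps_of_nat [symmetric] fps_const_neg [symmetric] del: fps_const_neg)
    then have "fps_of_poly [:1, - of_nat (card E):] * lang_gf D =
        fps_of_poly [:if [] \<in> D then 1 else 0:]
        + fps_of_poly [:0, 1:] * (\<Sum>a\<in>{..d} - E. lang_gf (?q a))"
      using solve[OF *] by (simp only:)
    then have "rational_gf d (fps_of_poly [:1, - of_nat (card E):] * lang_gf D)"
      using rest by (simp only:)
    then show ?case
      using E(1) by (rule rational_gf_divide)
  qed
qed

section \<open>Eventual polynomiality\<close>

lemma pcompose_power:
  fixes p q :: "'a :: comm_semiring_1 poly"
  shows "pcompose (p ^ n) q = pcompose p q ^ n"
  by (induction n) (simp_all add: pcompose_1 pcompose_mult)

text \<open>The difference of c x^(n+1) has leading term (n+1) c x^n. Choosing c to match the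
  leading term of \<open>p\<close> leaves a remainder \<open>r\<close> of smaller degree, or
  zero.\<close>

lemma poly_antidifference:
  fixes p :: "rat poly"
  shows "\<exists>q. \<forall>x. poly q (x + 1) - poly q x = poly p x"
proof (induction "degree p" arbitrary: p rule: less_induct)
  case less
  show ?case
  proof (cases "p = 0")
    case False
    define n where "n = degree p"
    define q where "q = monom (lead_coeff p / of_nat (Suc n)) (Suc n)"
    define r where "r = p - (pcompose q [:1, 1:] - q)"
    define c where "c = lead_coeff p / of_nat (Suc n)"
    \<comment> \<open>As a power of x, \<open>q\<close> becomes a power of x + 1 under the
      substitution, with binomial coefficients.\<close>
    have q: "q = smult c ([:0, 1:] ^ Suc n)"
      by (simp add: q_def c_def monom_altdef)
    have "pcompose q [:1, 1:] = smult c ([:1, 1:] ^ Suc n)"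
      by (simp add: q pcompose_smult pcompose_power pcompose_pCons del: power_Suc)
    then have cf: "coeff (pcompose q [:1, 1:]) i = c * of_nat (Suc n choose i)" for i
      by (cases "i \<le> Suc n")
        (simp_all add: coeff_linear_poly_power coeff_eq_0 degree_linear_power binomial_eq_0
          del: power_Suc binomial_Suc_Suc)
    have rc: "coeff r i = coeff p i - (c * of_nat (Suc n choose i) - (if i = Suc n then c else 0))" for i
      unfolding r_def by (simp only: coeff_diff cf) (simp add: q_def c_def)
    have "coeff r i = 0" if i: "i \<ge> n" for i
    proof -
      consider "i = n" | "i = Suc n" | "i > Suc n" using i by linarith
      then show ?thesis
        by cases (simp_all add: rc c_def n_def coeff_eq_0 binomial_eq_0 del: binomial_Suc_Suc of_nat_Suc)
    qed
    then have "r = 0 \<or> degree r < n"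
      using leading_coeff_0_iff[of r] by (cases "degree r < n") auto
    then obtain s where s: "\<forall>x. poly s (x + 1) - poly s x = poly r x"
      using less.hyps[of r] unfolding n_def by (metis diff_self poly_0)
    have "poly (q + s) (x + 1) - poly (q + s) x = poly p x" for x
      using s[rule_format, of x] by (simp add: r_def poly_pcompose algebra_simps)
    then show ?thesis
      by (intro exI[of _ "q + s"] allI)
  next
    case True
    then show ?thesis
      by (intro exI[of _ 0]) simp
  qed
qed

text \<open>Multiplication by 1 - t takes successive differences of the coefficients. By induction
  on the exponent these are eventually polynomial, and summing a polynomial gives a
  polynomial.\<close>

lemma eventually_poly_of_rational_gf:
  assumes "rational_gf 1 F"
  shows "\<exists>p. \<forall>\<^sub>F n in sequentially. F $ n = poly p (of_nat n)"
proof -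
  obtain f e where "F * fps_of_poly ([:1, -1:] ^ e) = fps_of_poly f"
    using assms by (auto simp: rational_gf_def)
  then show ?thesis
  proof (induction e arbitrary: F)
    case 0
    have "\<forall>\<^sub>F n in sequentially. F $ n = poly 0 (of_nat n)"
      using eventually_gt_at_top[of "degree f"]
      by eventually_elim (use 0 in \<open>auto simp: coeff_eq_0\<close>)
    then show ?case by blast
  next
    case (Suc e)
    have "F * fps_of_poly [:1, -1:] * fps_of_poly ([:1, -1:] ^ e) = fps_of_poly f"
      using Suc.prems by (simp only: power_Suc fps_of_poly_mult mult.assoc)
    from Suc.IH[OF this] obtain p where
      p: "\<forall>\<^sub>F n in sequentially. (F * fps_of_poly [:1, -1:]) $ n = poly p (of_nat n)" by blast
    have diff: "(F * fps_of_poly [:1, -1:]) $ Suc n = F $ Suc n - F $ n" for n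
    proof -
      have "fps_of_poly [:1, -1:] = (1 - fps_X :: rat fps)"
        by (simp add: fps_eq_iff coeff_pCons fps_X_def split: nat.splits)
      then show ?thesis
        by (simp only: right_diff_distrib) simp
    qed
    from p obtain N where N: "\<And>n. n \<ge> N \<Longrightarrow> F $ Suc n - F $ n = poly p (of_nat (Suc n))"
      unfolding eventually_sequentially by (metis diff le_Suc_eq)
    \<comment> \<open>The difference from n to n + 1 is the value of \<open>p\<close> at n + 1,
      hence the shift of the argument.\<close>
    obtain q where q: "\<And>x. poly q (x + 1) - poly q x = poly (pcompose p [:1, 1:]) x"
      using poly_antidifference by blast
    define c where "c = F $ N - poly q (of_nat N)"
    have "F $ n = poly (q + [:c:]) (of_nat n)" if "n \<ge> N" for n
      using that
    proof (induction n rule: dec_induct)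
      case (step n)
      then show ?case
        using N[of n] q[of "of_nat n"] by (simp add: poly_pcompose add.commute algebra_simps)
    qed (simp add: c_def)
    then show ?case
      by (intro exI[of _ "q + [:c:]"] eventually_sequentiallyI)
  qed
qed

section \<open>Pivots of an ordered spanning family\<close>

text \<open>The greedy choice of a basis, recorded by indices: when several indices carry the same
  vector, at most the least of them is chosen.\<close>

definition (in vectorspace) pivots :: "('i :: linorder \<Rightarrow> 'c) \<Rightarrow> 'i set \<Rightarrow> 'i set" where
  "pivots v W = {w \<in> W. v w \<notin> span (v ` {u \<in> W. u < w})}"

text \<open>Induction adding the largest index \<open>b\<close>. Whether an index is a pivot depends
  only on smaller ones, so the old pivots persist, and \<open>b\<close> joins them exactly when its
  vector enlarges the span.\<close>

lemma (in vectorspace) pivots_basis: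
  assumes "finite W" "v ` W \<subseteq> carrier V"
  shows "inj_on v (pivots v W)" "lin_indpt (v ` pivots v W)"
    "span (v ` pivots v W) = span (v ` W)"
proof -
  have "inj_on v (pivots v W) \<and> lin_indpt (v ` pivots v W) \<and> span (v ` pivots v W) = span (v ` W)"
    using assms
  proof (induction W rule: finite_linorder_max_induct)
    case empty
    have "lin_indpt {}"
      by (auto simp: lin_dep_def)
    then show ?case by (simp add: pivots_def)
  next
    case (insert b W)
    have lt: "{u \<in> insert b W. u < b} = W"
      using insert.hyps by auto
    have "{u \<in> insert b W. u < w} = {u \<in> W. u < w}" if "w \<in> W" for w
      using insert.hyps(2) that by force
    then have piv: "pivots v (insert b W) = (if v b \<in> span (v ` W) then {} else {b}) \<union> pivots v W"
      using lt insert.hyps(2) unfolding pivots_def by auto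
    have car: "v ` W \<subseteq> carrier V" "v b \<in> carrier V"
      using insert.prems by auto
    have sub: "pivots v W \<subseteq> W"
      by (auto simp: pivots_def)
    have IH: "inj_on v (pivots v W)" "lin_indpt (v ` pivots v W)"
      "span (v ` pivots v W) = span (v ` W)"
      using insert.IH car by auto
    show ?case
    proof (cases "v b \<in> span (v ` W)")
      case True
      then show ?thesis
        using IH already_in_span[OF car(1)] by (simp add: piv)
    next
      case False
      have pcar: "v ` pivots v W \<subseteq> carrier V"
        using sub car(1) by blast
      have nin: "v b \<notin> v ` pivots v W"
        using False in_own_span[OF car(1)] sub by blast
      have "lin_indpt (v ` pivots v W \<union> {v b})"
        using lin_dep_iff_in_span[OF pcar IH(2) car(2) nin] False IH(3) by simp
      moreover have "span (v ` pivots v W \<union> {v b}) = span (v ` W \<union> {v b})"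
        by (rule span_Un[OF pcar car(1)]) (use car(2) IH(3) in simp_all)
      moreover have "inj_on v ({b} \<union> pivots v W)"
        using IH(1) nin by auto
      ultimately show ?thesis
        using False by (simp add: piv)
    qed
  qed
  then show "inj_on v (pivots v W)" "lin_indpt (v ` pivots v W)"
    "span (v ` pivots v W) = span (v ` W)"
    by auto
qed

lemma (in vectorspace) dim_eq_card_pivots:
  assumes "finite W" "v ` W \<subseteq> carrier V" "span (v ` W) = carrier V"
  shows "fin_dim" "dim = card (pivots v W)"
proof -
  show fin_dim
    using assms unfolding fin_dim_def by blast
  have fin: "finite (pivots v W)"
    using assms(1) by (simp add: pivots_def)
  have "v ` pivots v W \<subseteq> carrier V"
    using assms(2) by (auto simp: pivots_def)
  then have "basis (v ` pivots v W)"
    using pivots_basis[OF assms(1,2)] assms(3) by (auto simp: basis_def)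
  then show "dim = card (pivots v W)"
    using dim_basis[of "v ` pivots v W"] fin card_image[OF pivots_basis(1)[OF assms(1,2)]] by simp
qed

section \<open>Linear maps and spans\<close>

lemma (in linear_map) subspace_vimage:
  assumes "VectorSpace.subspace K N W"
  shows "VectorSpace.subspace K {x \<in> carrier V. T x \<in> N} V"
proof -
  have N: "submodule K N W"
    using assms by (simp add: VectorSpace.subspace_def)
  have "submodule K {x \<in> carrier V. T x \<in> N} V"
    using V.module.module_axioms submodule.m_closed[OF N] submodule.zero_closed[OF N]
      submodule.smult_closed[OF N]
    by (auto intro!: submodule.intro)
  then show ?thesis
    using V.vectorspace_axioms by (simp add: VectorSpace.subspace_def)
qed

lemma (in linear_map) image_span_subset:
  assumes "B \<subseteq> carrier V"
  shows "T ` V.module.span B \<subseteq> W.module.span (T ` B)"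
proof -
  have TB: "T ` B \<subseteq> carrier W"
    using assms by auto
  have "V.module.span B \<subseteq> {x \<in> carrier V. T x \<in> W.module.span (T ` B)}"
  proof (rule V.module.span_is_subset)
    show "B \<subseteq> {x \<in> carrier V. T x \<in> W.module.span (T ` B)}"
      using assms W.module.in_own_span[OF TB] by auto
    show "submodule K {x \<in> carrier V. T x \<in> W.module.span (T ` B)} V"
      using subspace_vimage[OF W.span_is_subspace[OF TB]] by (simp add: VectorSpace.subspace_def)
  qed
  then show ?thesis by blast
qed

section \<open>Morphisms as words\<close>

text \<open>Positions of zeros, counted from 1 so that they are elements of \<open>[n]\<close>.\<close>

fun zeros :: "nat list \<Rightarrow> nat list" where
  "zeros [] = []"
| "zeros (a # w) = (if a = 0 then [1] else []) @ map Suc (zeros w)"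

lemma zeros_append: "zeros (u @ v) = zeros u @ map ((+) (length u)) (zeros v)"
  by (induction u) auto

lemma set_zeros: "set (zeros w) = {i \<in> {1..length w}. w ! (i - 1) = 0}"
proof (induction w)
  case (Cons a w)
  have "{i \<in> {1..length (a # w)}. (a # w) ! (i - 1) = 0}
      = (if a = 0 then {1} else {}) \<union> Suc ` {i \<in> {1..length w}. w ! (i - 1) = 0}"
  proof (rule Set.set_eqI)
    fix i
    show "i \<in> {i \<in> {1..length (a # w)}. (a # w) ! (i - 1) = 0} \<longleftrightarrow>
        i \<in> (if a = 0 then {1} else {}) \<union> Suc ` {i \<in> {1..length w}. w ! (i - 1) = 0}"
      by (cases i; cases "i - 1") (auto simp: image_iff)
  qed
  then show ?case using Cons by simp
qed simp

lemma distinct_zeros: "distinct (zeros w)"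
  by (induction w) (auto simp: distinct_map set_zeros)

lemma length_zeros: "length (zeros w) = count_list w 0"
  by (induction w) auto

text \<open>The k-th entry of \<open>xs\<close> goes to the position of the k-th zero; the other
  letters are the colours. The word records only the image of the injection, the order of
  \<open>xs\<close> the injection itself.\<close>

definition word_mor :: "nat list \<Rightarrow> nat list \<Rightarrow> fid_mor" where
  "word_mor xs w =
     (\<lambda>s\<in>set xs. the (map_of (zip xs (zeros w)) s),
      \<lambda>i\<in>{1..length w} - set (zeros w). w ! (i - 1))"

lemma map_fst_word_mor:
  assumes "distinct xs" "count_list w 0 = length xs"
  shows "map (fst (word_mor xs w)) xs = zeros w"
  using assms by (intro nth_equalityI) (auto simp: word_mor_def length_zeros map_of_zip_nth)

lemma image_fst_word_mor:
  assumes "distinct xs" "count_list w 0 = length xs"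
  shows "fst (word_mor xs w) ` set xs = set (zeros w)"
  using map_fst_word_mor[OF assms] by (metis set_map)

lemma word_mor_in_hom:
  assumes xs: "distinct xs" "count_list w 0 = length xs" and w: "set w \<subseteq> {..d}"
  shows "word_mor xs w \<in> fid_hom d (set xs) {1..length w}"
proof -
  have "inj_on (fst (word_mor xs w)) (set xs)"
    using map_fst_word_mor[OF xs] distinct_zeros[of w] by (metis distinct_map)
  moreover have "fst (word_mor xs w) ` set xs \<subseteq> {1..length w}"
    using image_fst_word_mor[OF xs] by (auto simp: set_zeros)
  moreover have "fst (word_mor xs w) \<in> extensional (set xs)"
    by (simp add: word_mor_def)
  moreover have "w ! (i - 1) \<in> {1..d}" if "i \<in> {1..length w} - set (zeros w)" for i
  proof -
    have "w ! (i - 1) \<in> set w" using that by (intro nth_mem) auto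
    then show ?thesis using that w by (auto simp: set_zeros)
  qed
  then have "snd (word_mor xs w) \<in> ({1..length w} - fst (word_mor xs w) ` set xs) \<rightarrow>\<^sub>E {1..d}"
    unfolding image_fst_word_mor[OF xs] by (auto simp: word_mor_def)
  ultimately show ?thesis
    unfolding fid_hom_def by (auto simp: case_prod_unfold PiE_def)
qed

text \<open>The word is read off from the image and the colours. As colours are at least 1, its
  zeros are exactly the image.\<close>

lemma fid_hom_obtain_word:
  assumes \<phi>: "\<phi> \<in> fid_hom d S {1..n}" and "finite S"
  obtains xs w where "distinct xs" "set xs = S" "length w = n" "set w \<subseteq> {..d}"
    "count_list w 0 = length xs" "word_mor xs w = \<phi>"
proof -
  obtain f g where fg: "\<phi> = (f, g)" by (cases \<phi>)
  have f: "f \<in> S \<rightarrow>\<^sub>E {1..n}" "inj_on f S" and g: "g \<in> ({1..n} - f ` S) \<rightarrow>\<^sub>E {1..d}"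
    using \<phi> by (auto simp: fid_hom_def fg)
  define w where "w = map (\<lambda>i. if i \<in> f ` S then 0 else g i) [1..<Suc n]"
  have w_nth: "w ! (i - 1) = (if i \<in> f ` S then 0 else g i)" if "i \<in> {1..n}" for i
    using that unfolding w_def by (subst nth_map) (auto simp del: upt_Suc)
  have len: "length w = n" by (simp add: w_def)
  have g_range: "g i \<in> {1..d}" if "i \<in> {1..n}" "i \<notin> f ` S" for i
    using g that by blast
  have zeros_w: "set (zeros w) = f ` S"
  proof (rule Set.set_eqI)
    fix i
    show "i \<in> set (zeros w) \<longleftrightarrow> i \<in> f ` S"
    proof (cases "i \<in> {1..n}")
      case True
      have "w ! (i - 1) = 0 \<longleftrightarrow> i \<in> f ` S"
        unfolding w_nth[OF True] using g_range[OF True] by auto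
      then show ?thesis
        using True by (simp add: set_zeros len)
    next
      case False
      then show ?thesis
        using f(1) by (auto simp: set_zeros len)
    qed
  qed
  have letters: "set w \<subseteq> {..d}"
    using g_range by (fastforce simp: w_def)
  \<comment> \<open>\<open>S\<close> listed in increasing order of the values of \<open>f\<close>,
    since \<open>zeros w\<close> is increasing.\<close>
  define xs where "xs = map (inv_into S f) (zeros w)"
  have set_xs: "set xs = S"
    using f(2) by (simp add: xs_def zeros_w image_image inv_into_f_f cong: image_cong)
  have dist: "distinct xs"
    by (simp add: xs_def distinct_map distinct_zeros zeros_w inj_on_inv_into)
  have cnt: "count_list w 0 = length xs"
    by (simp add: xs_def length_zeros)
  have "map f xs = zeros w"
    unfolding xs_def map_map by (rule map_idI) (simp add: zeros_w f_inv_into_f)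
  then have "\<forall>s\<in>S. fst (word_mor xs w) s = f s"
    using map_fst_word_mor[OF dist cnt] set_xs by (metis map_eq_conv)
  moreover have hom: "word_mor xs w \<in> fid_hom d S {1..n}"
    using word_mor_in_hom[OF dist cnt letters] by (simp add: set_xs len)
  ultimately have 1: "fst (word_mor xs w) = f"
    using f(1) by (intro extensionalityI[of _ S]) (auto simp: fid_hom_def case_prod_unfold PiE_def)
  have 2: "snd (word_mor xs w) = g"
  proof (rule extensionalityI[of _ "{1..n} - f ` S"])
    show "snd (word_mor xs w) \<in> extensional ({1..n} - f ` S)"
      by (simp add: word_mor_def zeros_w len)
    show "g \<in> extensional ({1..n} - f ` S)"
      using g by (simp add: PiE_def)
    show "snd (word_mor xs w) i = g i" if "i \<in> {1..n} - f ` S" for i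
      using that w_nth[of i] by (simp add: word_mor_def zeros_w len)
  qed
  show thesis
    using that[OF dist set_xs len letters cnt] 1 2 by (simp add: fg prod_eq_iff)
qed

section \<open>Insertion of a letter as composition with a morphism\<close>

definition insert_mor :: "nat \<Rightarrow> nat \<Rightarrow> nat \<Rightarrow> fid_mor" where
  "insert_mor n p c = (\<lambda>i\<in>{1..n}. if i \<le> p then i else Suc i, \<lambda>i\<in>{Suc p}. c)"

lemma insert_mor_image:
  assumes "p \<le> n"
  shows "fst (insert_mor n p c) ` {1..n} = {1..Suc n} - {Suc p}"
proof (intro equalityI subsetI)
  fix i assume i: "i \<in> {1..Suc n} - {Suc p}"
  show "i \<in> fst (insert_mor n p c) ` {1..n}"
  proof (cases "i \<le> p")
    case True
    then show ?thesis using i assms by (intro image_eqI[of _ _ i]) (auto simp: insert_mor_def)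
  next
    case False
    then show ?thesis using i assms by (intro image_eqI[of _ _ "i - 1"]) (auto simp: insert_mor_def)
  qed
qed (auto simp: insert_mor_def split: if_splits)

lemma insert_mor_in_hom:
  assumes "p \<le> n" "c \<in> {1..d}"
  shows "insert_mor n p c \<in> fid_hom d {1..n} {1..Suc n}"
proof -
  have "{1..Suc n} - fst (insert_mor n p c) ` {1..n} = {Suc p}"
    using assms by (subst insert_mor_image) auto
  moreover have "inj_on (fst (insert_mor n p c)) {1..n}"
    by (auto simp: inj_on_def insert_mor_def split: if_splits)
  ultimately show ?thesis
    using assms unfolding fid_hom_def by (auto simp: case_prod_unfold insert_mor_def)
qed

text \<open>As \<open>c\<close> is nonzero, insertion creates no zero: zeros of \<open>u\<close>
  stay and those of \<open>v\<close> move up by one, as under the injection of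
  \<open>insert_mor\<close>. The one new position gets colour \<open>c\<close>; the others keep
  their colours.\<close>

lemma comp_insert_mor_word_mor:
  assumes xs: "distinct xs" "count_list (u @ v) 0 = length xs" and uv: "set (u @ v) \<subseteq> {..d}"
    and c: "c \<in> {1..d}" and n: "length (u @ v) = n"
  shows "fid_comp (set xs) {1..n} {1..Suc n} (insert_mor n (length u) c) (word_mor xs (u @ v))
    = word_mor xs (u @ c # v)"
proof -
  let ?p = "length u"
  let ?\<phi> = "word_mor xs (u @ v)" and ?\<psi> = "insert_mor n ?p c" and ?\<chi> = "word_mor xs (u @ c # v)"
  let ?c = "fid_comp (set xs) {1..n} {1..Suc n} ?\<psi> ?\<phi>"
  have len: "length (u @ c # v) = Suc n" using n by simp
  have xs': "count_list (u @ c # v) 0 = length xs" using xs c by simp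
  have \<phi>: "?\<phi> \<in> fid_hom d (set xs) {1..n}"
    using word_mor_in_hom[OF xs uv] n by simp
  have \<psi>: "?\<psi> \<in> fid_hom d {1..n} {1..Suc n}"
    using insert_mor_in_hom c n by simp
  have \<chi>: "?\<chi> \<in> fid_hom d (set xs) {1..Suc n}"
    using word_mor_in_hom[OF xs(1) xs', of d] uv c len by auto
  have comp: "?c \<in> fid_hom d (set xs) {1..Suc n}"
    by (rule fid_comp_in_hom[OF \<phi> \<psi>])
  have zeros_n: "set (zeros (u @ v)) \<subseteq> {1..n}"
    using n by (auto simp: set_zeros)
  have zeros_uv: "zeros (u @ c # v) = map (fst ?\<psi>) (zeros (u @ v))"
  proof -
    have "map (fst ?\<psi>) (zeros u) = zeros u"
      using n by (intro map_idI) (auto simp: insert_mor_def set_zeros)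
    moreover have "map (fst ?\<psi>) (map ((+) ?p) (zeros v)) = map ((+) ?p) (map Suc (zeros v))"
      using n by (auto simp: insert_mor_def set_zeros)
    ultimately show ?thesis
      using c by (simp add: zeros_append)
  qed
  have fst_c: "fst ?c s = fst ?\<psi> (fst ?\<phi> s)" if "s \<in> set xs" for s
    using that by (simp add: fid_comp_def compose_def case_prod_unfold Let_def)
  then have "map (fst ?c) xs = map (fst ?\<psi>) (map (fst ?\<phi>) xs)"
    by simp
  also have "\<dots> = map (fst ?\<chi>) xs"
    by (simp only: map_fst_word_mor[OF xs] map_fst_word_mor[OF xs(1) xs'] zeros_uv)
  finally have "\<forall>s\<in>set xs. fst ?c s = fst ?\<chi> s"
    by simp
  then have 1: "fst ?c = fst ?\<chi>"
    using comp \<chi> by (intro extensionalityI[of _ "set xs"]) (auto simp: fid_hom_def PiE_def)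
  have dom: "{1..Suc n} - fst ?c ` set xs = {1..Suc n} - set (zeros (u @ c # v))"
    unfolding 1 image_fst_word_mor[OF xs(1) xs'] ..
  have 2: "snd ?c = snd ?\<chi>"
  proof (rule extensionalityI[of _ "{1..Suc n} - set (zeros (u @ c # v))"])
    show "snd ?c \<in> extensional ({1..Suc n} - set (zeros (u @ c # v)))"
      using comp unfolding dom[symmetric] by (auto simp: fid_hom_def PiE_def)
    show "snd ?\<chi> \<in> extensional ({1..Suc n} - set (zeros (u @ c # v)))"
      using len by (simp add: word_mor_def)
    fix y assume y: "y \<in> {1..Suc n} - set (zeros (u @ c # v))"
    have \<chi>y: "snd ?\<chi> y = (u @ c # v) ! (y - 1)"
      using y len by (simp add: word_mor_def)
    show "snd ?c y = snd ?\<chi> y"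
    proof (cases "y = Suc ?p")
      \<comment> \<open>The only position that the injection misses, so its colour comes from
        \<open>insert_mor\<close>.\<close>
      case True
      have "y \<in> {1..Suc n} - fst ?\<psi> ` {1..n}"
        using n True by (subst insert_mor_image) auto
      then have "snd ?c y = snd ?\<psi> y"
        using snd_fid_comp_outside[of "fst ?\<phi>" "snd ?\<phi>" d "set xs" "{1..n}" y "{1..Suc n}"
            "fst ?\<psi>" "snd ?\<psi>"] \<phi> by simp
      then show ?thesis
        unfolding \<chi>y using True by (simp add: insert_mor_def)
    next
      case False
      then have "y \<in> fst ?\<psi> ` {1..n}"
        using y n by (subst insert_mor_image) auto
      then obtain t where t: "t \<in> {1..n}" "y = fst ?\<psi> t" by blast
      then have "t \<notin> set (zeros (u @ v))"
        using y zeros_uv by auto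
      moreover from this have "t \<in> {1..n} - fst ?\<phi> ` set xs"
        using t(1) image_fst_word_mor[OF xs] by simp
      then have "snd ?c y = snd ?\<phi> t"
        using snd_fid_comp_inside[of "fst ?\<phi>" "snd ?\<phi>" d "set xs" "{1..n}"
            "fst ?\<psi>" "snd ?\<psi>" "{1..Suc n}" t] \<phi> \<psi> t(2) by simp
      ultimately have "snd ?c y = (u @ v) ! (t - 1)"
        using t(1) n by (simp add: word_mor_def)
      moreover have "(u @ v) ! (t - 1) = (u @ c # v) ! (y - 1)"
      proof (cases "t \<le> ?p")
        case True
        then show ?thesis
          using t by (auto simp: insert_mor_def nth_append)
      next
        case False
        \<comment> \<open>Beyond \<open>u\<close>, the index into \<open>c # v\<close> is one more
          than the index into \<open>v\<close>.\<close>
        then have "t - ?p = Suc (t - 1 - ?p)" by simp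
        then show ?thesis
          using t False by (auto simp: insert_mor_def nth_append)
      qed
      ultimately show ?thesis
        unfolding \<chi>y by simp
    qed
  qed
  show ?thesis
    using 1 2 by (simp add: prod_eq_iff)
qed

text \<open>The first difference decides, and inserting the same letter at the same place leaves it
  or shifts it by one in both words. Equal lengths exclude comparison with a proper prefix, where
  the claim can fail.\<close>

lemma insert_less:
  fixes a b :: "'a :: linorder list"
  assumes "length a = length b" "a < b"
  shows "take p a @ c # drop p a < take p b @ c # drop p b"
  using assms
proof (induction a b arbitrary: p rule: list_induct2)
  case (Cons x xs y ys)
  then show ?case by (cases p) auto
qed simp

section \<open>Standard words of a finitely generated module\<close>

lemma (in fid_module) act_closed:
  assumes "finite S" "finite T" "\<phi> \<in> fid_hom d S T" "x \<in> carrier (M S)"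
  shows "act S T \<phi> x \<in> carrier (M T)"
proof -
  interpret linear_map K "M S" "M T" "act S T \<phi>"
    using assms by (intro mor)
  show ?thesis using assms(4) by simp
qed

lemma (in fid_module) act_image_span:
  assumes "finite S" "finite T" "\<phi> \<in> fid_hom d S T" "B \<subseteq> carrier (M S)"
  shows "act S T \<phi> ` LinearCombinations.module.span K (M S) B \<subseteq> LinearCombinations.module.span K (M T) (act S T \<phi> ` B)"
proof -
  interpret linear_map K "M S" "M T" "act S T \<phi>"
    using assms by (intro mor)
  show ?thesis using image_span_subset[OF assms(4)] .
qed

lemma (in fid_module) module_value: "finite S \<Longrightarrow> Module.module K (M S)"
  using obj by (simp add: vectorspace_def)

text \<open>These spans form a submodule, because composites of morphisms are morphisms, and contain
  the generators, through the identities. Finite generation makes this submodule everything.\<close>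

lemma (in fid_module) span_generators:
  assumes fin: "\<forall>(S, x)\<in>G. finite S \<and> x \<in> carrier (M S)"
    and gen: "\<forall>N. fid_submodule N \<and> (\<forall>(S, x)\<in>G. x \<in> N S) \<longrightarrow> (\<forall>S. finite S \<longrightarrow> N S = carrier (M S))"
    and T: "finite T"
  shows "LinearCombinations.module.span K (M T) {act S T \<phi> x | S x \<phi>. (S, x) \<in> G \<and> \<phi> \<in> fid_hom d S T} = carrier (M T)"
proof -
  define B where "B T = {act S T \<phi> x | S x \<phi>. (S, x) \<in> G \<and> \<phi> \<in> fid_hom d S T}" for T
  define N where "N T = LinearCombinations.module.span K (M T) (B T)" for T
  have B: "B T \<subseteq> carrier (M T)" if "finite T" for T
    using fin that by (auto simp: B_def intro!: act_closed)
  have "fid_submodule N"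
    unfolding fid_submodule_def
  proof (intro conjI allI impI ballI)
    fix T :: "nat set" assume "finite T"
    then show "VectorSpace.subspace K (N T) (M T)"
      unfolding N_def using vectorspace.span_is_subspace[OF obj] B by blast
  next
    fix T U \<psi> assume \<psi>: "\<psi> \<in> fid_hom d T U" and TU: "finite T" "finite U"
    have "act T U \<psi> ` B T \<subseteq> B U"
    proof
      fix y assume "y \<in> act T U \<psi> ` B T"
      then obtain S x \<phi> where *: "(S, x) \<in> G" "\<phi> \<in> fid_hom d S T" "y = act T U \<psi> (act S T \<phi> x)"
        by (auto simp: B_def)
      then have "y = act S U (fid_comp S T U \<psi> \<phi>) x"
        using fin TU \<psi> act_comp[of S T U \<phi> \<psi> x] by auto
      then show "y \<in> B U"
        unfolding B_def using *(1) fid_comp_in_hom[OF *(2) \<psi>] by blast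
    qed
    then have "LinearCombinations.module.span K (M U) (act T U \<psi> ` B T) \<subseteq> N U"
      unfolding N_def by (rule LinearCombinations.module.span_is_monotone[OF module_value[OF TU(2)]])
    then show "act T U \<psi> ` N T \<subseteq> N U"
      using act_image_span[OF TU \<psi> B[OF TU(1)]] unfolding N_def by blast
  qed
  moreover have "\<forall>(S, x)\<in>G. x \<in> N S"
  proof clarify
    fix S x assume Sx: "(S, x) \<in> G"
    then have S: "finite S" "x \<in> carrier (M S)" using fin by auto
    have "act S S (fid_id S) x \<in> B S"
      unfolding B_def using Sx fid_id_in_hom by blast
    then have "x \<in> B S"
      using act_id[OF S] by simp
    then show "x \<in> N S"
      using LinearCombinations.module.in_own_span[OF module_value[OF S(1)] B[OF S(1)]] by (auto simp: N_def)
  qed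
  ultimately have "N T = carrier (M T)"
    using gen[THEN spec, of N] T by simp
  then show ?thesis by (simp add: N_def B_def)
qed

text \<open>
  A label is an index into a list \<open>L\<close> of pairs (enumeration of \<open>S\<close>, element of \<open>M S\<close>). It is put in
  front of the word, so that the order on lists compares labels first.
\<close>

definition words :: "nat \<Rightarrow> (nat list \<times> 'v) list \<Rightarrow> nat \<Rightarrow> nat list set" where
  "words d L n = {l # w | l w. l < length L \<and> length w = n \<and> set w \<subseteq> {..d}
     \<and> count_list w 0 = length (fst (L ! l))}"

lemma finite_words: "finite (words d L n)"
proof (rule finite_subset)
  show "words d L n \<subseteq> (\<lambda>(l, w). l # w) ` ({..<length L} \<times> {w. set w \<subseteq> {..d} \<and> length w = n})"
    by (auto simp: words_def image_iff)
qed (intro finite_imageI finite_cartesian_product finite_lists_length_eq; simp)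

definition (in fid_module) word_vec :: "(nat list \<times> 'v) list \<Rightarrow> nat list \<Rightarrow> 'v" where
  "word_vec L z = (let (xs, x) = L ! hd z; w = tl z
     in act (set xs) {1..length w} (word_mor xs w) x)"

definition (in fid_module) standard :: "(nat list \<times> 'v) list \<Rightarrow> nat \<Rightarrow> nat list set" where
  "standard L n = vectorspace.pivots K (M {1..n}) (word_vec L) (words d L n)"

text \<open>Finite generation in terms of words alone; the arguments on standard words then depend
  only on \<open>L\<close>.\<close>

locale enumerated_generators = fid_module d K M act
  for d and K :: "('k, 'r) ring_scheme" and M :: "nat set \<Rightarrow> ('k, 'v, 'm) module_scheme" and act +
  fixes L :: "(nat list \<times> 'v) list"
  assumes gens: "\<And>xs x. (xs, x) \<in> set L \<Longrightarrow> distinct xs \<and> x \<in> carrier (M (set xs))"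
    and spanning: "\<And>n. LinearCombinations.module.span K (M {1..n})
      {act (set xs) {1..n} (word_mor xs w) x | xs x w. (xs, x) \<in> set L \<and>
         length w = n \<and> set w \<subseteq> {..d} \<and> count_list w 0 = length xs}
      = carrier (M {1..n})"
begin

lemma word_vec_Cons:
  "L ! l = (xs, x) \<Longrightarrow> word_vec L (l # w) = act (set xs) {1..length w} (word_mor xs w) x"
  by (simp add: word_vec_def)

lemma word_vec_closed: "word_vec L ` words d L n \<subseteq> carrier (M {1..n})"
proof
  fix y assume "y \<in> word_vec L ` words d L n"
  then obtain l w where lw: "l < length L" "length w = n" "set w \<subseteq> {..d}"
      "count_list w 0 = length (fst (L ! l))" "y = word_vec L (l # w)"
    by (auto simp: words_def)
  obtain xs x where xs: "L ! l = (xs, x)" by fastforce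
  then have "distinct xs" "x \<in> carrier (M (set xs))"
    using gens lw(1) nth_mem by metis+
  then show "y \<in> carrier (M {1..n})"
    using lw xs word_mor_in_hom[of xs w d] by (auto simp: word_vec_Cons intro!: act_closed)
qed

lemma word_vec_spanning:
  "LinearCombinations.module.span K (M {1..n}) (word_vec L ` words d L n) = carrier (M {1..n})"
proof
  interpret vectorspace K "M {1..n}" by (rule obj) simp
  show "module.span (word_vec L ` words d L n) \<subseteq> carrier (M {1..n})"
    by (rule module.span_is_subset2[OF word_vec_closed])
  have "{act (set xs) {1..n} (word_mor xs w) x | xs x w. (xs, x) \<in> set L \<and>
         length w = n \<and> set w \<subseteq> {..d} \<and> count_list w 0 = length xs}
      \<subseteq> word_vec L ` words d L n" (is "?A \<subseteq> _")
  proof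
    fix y assume "y \<in> ?A"
    then obtain xs x w where *: "(xs, x) \<in> set L" "length w = n" "set w \<subseteq> {..d}"
        "count_list w 0 = length xs" "y = act (set xs) {1..n} (word_mor xs w) x" by blast
    then obtain l where l: "l < length L" "L ! l = (xs, x)" by (auto simp: in_set_conv_nth)
    have "l # w \<in> words d L n" "y = word_vec L (l # w)"
      using * l by (auto simp: words_def word_vec_Cons)
    then show "y \<in> word_vec L ` words d L n" by blast
  qed
  from module.span_is_monotone[OF this]
  show "carrier (M {1..n}) \<subseteq> module.span (word_vec L ` words d L n)"
    by (simp only: spanning)
qed

lemma hilbert_fun_eq: "vectorspace.fin_dim K (M {1..n})" "hilbert_fun n = card (standard L n)"
  using vectorspace.dim_eq_card_pivots[OF obj finite_words word_vec_closed word_vec_spanning]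
  by (simp_all add: hilbert_fun_def standard_def)

text \<open>The label occupies the first place of \<open>z\<close>, so position \<open>p\<close> of
  the word is position \<open>Suc p\<close> here, and the label is kept.\<close>

lemma word_vec_insert:
  assumes z: "z \<in> words d L n" and p: "p \<le> n" and c: "c \<in> {1..d}"
  defines "z' \<equiv> take (Suc p) z @ c # drop (Suc p) z"
  shows "z' \<in> words d L (Suc n)"
    "act {1..n} {1..Suc n} (insert_mor n p c) (word_vec L z) = word_vec L z'"
proof -
  obtain l w where lw: "z = l # w" "l < length L" "length w = n" "set w \<subseteq> {..d}"
      "count_list w 0 = length (fst (L ! l))"
    using z by (auto simp: words_def)
  obtain xs x where xs: "L ! l = (xs, x)" by fastforce
  then have x: "distinct xs" "x \<in> carrier (M (set xs))"
    using gens lw(2) nth_mem by metis+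
  define u v where "u = take p w" and "v = drop p w"
  have w: "w = u @ v" and u: "length u = p"
    using lw(3) p by (auto simp: u_def v_def)
  have z': "z' = l # u @ c # v"
    by (simp add: z'_def lw(1) u_def v_def)
  show "z' \<in> words d L (Suc n)"
    using lw c w by (auto simp: z' words_def)
  have hom: "word_mor xs w \<in> fid_hom d (set xs) {1..n}" "insert_mor n p c \<in> fid_hom d {1..n} {1..Suc n}"
    using word_mor_in_hom[of xs w d] x lw xs insert_mor_in_hom[OF p c] by auto
  have "act {1..n} {1..Suc n} (insert_mor n p c) (word_vec L z)
      = act (set xs) {1..Suc n} (fid_comp (set xs) {1..n} {1..Suc n} (insert_mor n p c) (word_mor xs w)) x"
    using act_comp[OF _ _ _ hom x(2)] lw(1,3) xs by (simp add: word_vec_Cons)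
  also have "\<dots> = word_vec L z'"
    using comp_insert_mor_word_mor[of xs u v d c n] x lw xs c u w by (simp add: z' word_vec_Cons)
  finally show "act {1..n} {1..Suc n} (insert_mor n p c) (word_vec L z) = word_vec L z'" .
qed

text \<open>Contrapositive: if the vector of the shorter word is a combination of vectors of smaller
  words, the action of \<open>insert_mor\<close> turns this into such a combination for the longer
  word, as insertion preserves the order.\<close>

lemma standard_delete:
  assumes st: "l # u @ c # v \<in> standard L (Suc n)" and c: "c \<noteq> 0"
  shows "l # u @ v \<in> standard L n"
proof -
  let ?z = "l # u @ v" and ?ins = "\<lambda>z. take (Suc (length u)) z @ c # drop (Suc (length u)) z"
  let ?\<psi> = "insert_mor n (length u) c"
  have vs: "vectorspace K (M {1..k})" for k by (rule obj) simp
  interpret V: vectorspace K "M {1..n}" by (rule vs)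
  interpret W: vectorspace K "M {1..Suc n}" by (rule vs)
  have w: "l # u @ c # v \<in> words d L (Suc n)"
    and nin: "word_vec L (l # u @ c # v) \<notin>
      W.module.span (word_vec L ` {z \<in> words d L (Suc n). z < l # u @ c # v})"
    using st unfolding standard_def W.pivots_def by blast+
  have z: "?z \<in> words d L n" and c': "c \<in> {1..d}" and u: "length u \<le> n"
    using w c by (auto simp: words_def)
  have \<psi>: "?\<psi> \<in> fid_hom d {1..n} {1..Suc n}"
    by (rule insert_mor_in_hom[OF u c'])
  have ins_z: "?ins ?z = l # u @ c # v" by simp
  let ?B = "{z \<in> words d L n. z < ?z}"
  have "word_vec L ?z \<notin> V.module.span (word_vec L ` ?B)"
  proof
    assume "word_vec L ?z \<in> V.module.span (word_vec L ` ?B)"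
    moreover have "word_vec L ` ?B \<subseteq> carrier (M {1..n})"
      using word_vec_closed by blast
    ultimately have "act {1..n} {1..Suc n} ?\<psi> (word_vec L ?z)
        \<in> W.module.span (act {1..n} {1..Suc n} ?\<psi> ` word_vec L ` ?B)"
      using act_image_span[OF _ _ \<psi>, of "word_vec L ` ?B"] by auto
    moreover have "act {1..n} {1..Suc n} ?\<psi> ` word_vec L ` ?B
        \<subseteq> word_vec L ` {z \<in> words d L (Suc n). z < l # u @ c # v}"
    proof clarify
      fix y assume y: "y \<in> words d L n" "y < ?z"
      \<comment> \<open>\<open>insert_less\<close> compares words of equal length; here both consist
        of a label and \<open>n\<close> letters.\<close>
      then have "length y = length ?z"
        using z by (auto simp: words_def)
      then have "?ins y < l # u @ c # v"
        using insert_less[OF _ y(2), of "Suc (length u)" c] ins_z by simp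
      then show "act {1..n} {1..Suc n} ?\<psi> (word_vec L y)
          \<in> word_vec L ` {z \<in> words d L (Suc n). z < l # u @ c # v}"
        using word_vec_insert[OF y(1) u c'] by blast
    qed
    ultimately have "act {1..n} {1..Suc n} ?\<psi> (word_vec L ?z)
        \<in> W.module.span (word_vec L ` {z \<in> words d L (Suc n). z < l # u @ c # v})"
      using W.module.span_is_monotone by blast
    then show False
      using nin word_vec_insert(2)[OF z u c'] by simp
  qed
  then show ?thesis
    unfolding standard_def V.pivots_def using z by blast
qed

end

text \<open>Each generator (S, x) enters \<open>L\<close> once for every enumeration of S: a fixed
  enumeration reaches only the injections that are increasing along it.\<close>

lemma (in fid_module) obtain_enumerated_generators:
  assumes finitely_generated
  obtains L where "enumerated_generators d K M act L"
proof -
  obtain G where H: "finite G \<and> (\<forall>(S, x)\<in>G. finite S \<and> x \<in> carrier (M S)) \<and>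
      (\<forall>N. fid_submodule N \<and> (\<forall>(S, x)\<in>G. x \<in> N S) \<longrightarrow> (\<forall>S. finite S \<longrightarrow> N S = carrier (M S)))"
    using assms unfolding finitely_generated_def by (elim exE) (rule that)
  note G = H[THEN conjunct1] H[THEN conjunct2, THEN conjunct1]
    and gen = H[THEN conjunct2, THEN conjunct2]
  define A where "A = {(xs, x). distinct xs \<and> (set xs, x) \<in> G}"
  have "finite (\<Union>(fst ` G))"
    using G by (intro finite_Union) auto
  then have "finite ({xs. set xs \<subseteq> \<Union>(fst ` G) \<and> distinct xs} \<times> snd ` G)"
    using G(1) by (intro finite_cartesian_product finite_subset_distinct) auto
  then have "finite A"
    by (rule rev_finite_subset) (force simp: A_def)
  then obtain L where L: "set L = A"
    using finite_list by blast
  have "enumerated_generators d K M act L"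
  proof
    fix xs x assume "(xs, x) \<in> set L"
    then show "distinct xs \<and> x \<in> carrier (M (set xs))"
      using G(2) by (auto simp: L A_def)
  next
    fix n
    have "{act S {1..n} \<phi> x | S x \<phi>. (S, x) \<in> G \<and> \<phi> \<in> fid_hom d S {1..n}}
      = {act (set xs) {1..n} (word_mor xs w) x | xs x w. (xs, x) \<in> set L \<and>
         length w = n \<and> set w \<subseteq> {..d} \<and> count_list w 0 = length xs}"
      (is "?A = ?B")
    proof
      show "?A \<subseteq> ?B"
      proof
        fix y assume "y \<in> ?A"
        then obtain S x \<phi> where *: "(S, x) \<in> G" "\<phi> \<in> fid_hom d S {1..n}" "y = act S {1..n} \<phi> x"
          by blast
        then have "finite S" using G(2) by auto
        obtain xs w where w: "distinct xs" "set xs = S" "length w = n" "set w \<subseteq> {..d}"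
            "count_list w 0 = length xs" "word_mor xs w = \<phi>"
          by (rule fid_hom_obtain_word[OF *(2) \<open>finite S\<close>])
        then have "(xs, x) \<in> set L" using * by (simp add: L A_def)
        then show "y \<in> ?B"
          using *(3) w by blast
      qed
      show "?B \<subseteq> ?A"
      proof
        fix y assume "y \<in> ?B"
        then obtain xs x w where *: "(xs, x) \<in> A" "length w = n" "set w \<subseteq> {..d}"
            "count_list w 0 = length xs" "y = act (set xs) {1..n} (word_mor xs w) x"
          unfolding L by blast
        then have "word_mor xs w \<in> fid_hom d (set xs) {1..n}"
          using word_mor_in_hom[of xs w d] by (auto simp: A_def)
        then show "y \<in> ?A"
          using * unfolding A_def by blast
      qed
    qed
    then show "LinearCombinations.module.span K (M {1..n}) ?B = carrier (M {1..n})"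
      using span_generators[OF G(2) gen, of "{1..n}"] by simp
  qed
  then show thesis by (rule that)
qed

section \<open>Counting standard words label by label\<close>

context enumerated_generators
begin

text \<open>All n are collected in one language, since the length of \<open>w\<close> recovers
  n.\<close>

definition standard_words :: "nat \<Rightarrow> nat list set" where
  "standard_words l = {w. l # w \<in> standard L (length w)}"

lemma standard_subset: "standard L n \<subseteq> words d L n"
proof -
  interpret vectorspace K "M {1..n}" by (rule obj) simp
  show ?thesis unfolding standard_def pivots_def by blast
qed

lemma downset_standard_words: "downset d (length (fst (L ! l))) (standard_words l)"
  unfolding downset_def
proof (intro conjI ballI allI impI)
  fix w assume "w \<in> standard_words l"
  then have "l # w \<in> words d L (length w)"
    using standard_subset by (auto simp: standard_words_def)
  then show "set w \<subseteq> {..d}" "count_list w 0 = length (fst (L ! l))"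
    by (simp_all add: words_def)
next
  fix u c v assume "u @ c # v \<in> standard_words l" "c \<noteq> 0"
  then show "u @ v \<in> standard_words l"
    using standard_delete[of l u c v "length (u @ v)"] by (simp add: standard_words_def)
qed

lemma card_standard:
  "card (standard L n) = (\<Sum>l<length L. card {w \<in> standard_words l. length w = n})"
proof -
  have "standard L n = (\<Union>l<length L. (#) l ` {w \<in> standard_words l. length w = n})"
  proof (intro equalityI subsetI)
    fix z assume z: "z \<in> standard L n"
    then have "z \<in> words d L n"
      using standard_subset by blast
    then obtain l w where "z = l # w" "l < length L" "length w = n"
      by (auto simp: words_def)
    then show "z \<in> (\<Union>l<length L. (#) l ` {w \<in> standard_words l. length w = n})"
      using z by (auto simp: standard_words_def)
  qed (auto simp: standard_words_def)
  moreover have "finite {w \<in> standard_words l. length w = n}" for l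
    using downsetD(1)[OF downset_standard_words[of l]]
    by (intro finite_subset[OF _ finite_lists_length_eq[of "{..d}" n]]) auto
  ultimately show ?thesis
    by (simp, subst card_UN_disjoint) (auto simp: card_image)
qed

lemma rational_hilbert_series: "rational_gf d hilbert_series"
proof -
  have "hilbert_series = (\<Sum>l<length L. lang_gf (standard_words l))"
    by (rule fps_ext)
      (simp add: hilbert_series_def hilbert_fun_eq(2) card_standard lang_gf_def fps_sum_nth)
  then show ?thesis
    using downset_standard_words by (auto intro!: rational_gf_sum rational_lang_gf)
qed

end

theorem corollary7p1p7:
  fixes d :: nat
    and K :: "('k, 'r) ring_scheme"
    and M :: "nat set \<Rightarrow> ('k, 'v, 'm) module_scheme"
    and act :: "nat set \<Rightarrow> nat set \<Rightarrow> fid_mor \<Rightarrow> 'v \<Rightarrow> 'v"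
  assumes "d \<ge> 1"
    and "field K"
    and "fid_module d K M act"
    and "fid_module.finitely_generated d K M act"
  shows "(\<forall>n. vectorspace.fin_dim K (M {1..n})) \<and>
    (\<exists>(f :: rat poly) (g :: rat poly) (e :: nat \<Rightarrow> nat).
       g = (\<Prod>j = 1..d. [:1, - of_nat j:] ^ e j) \<and>
       fid_module.hilbert_series K M = fps_of_poly f / fps_of_poly g) \<and>
    (d = 1 \<longrightarrow> (\<exists>p :: rat poly. \<forall>\<^sub>F n in sequentially.
       of_nat (fid_module.hilbert_fun K M n) = poly p (of_nat n)))"
proof (intro conjI allI impI)
  interpret fid_module d K M act by fact
  obtain L where "enumerated_generators d K M act L"
    by (rule obtain_enumerated_generators[OF assms(4)])
  then interpret enumerated_generators d K M act L .
  show "vectorspace.fin_dim K (M {1..n})" for n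
    by (rule hilbert_fun_eq)
  obtain f e where fe: "hilbert_series * fps_of_poly (\<Prod>j = 1..d. [:1, - of_nat j:] ^ e j) = fps_of_poly f"
    using rational_hilbert_series unfolding rational_gf_def by blast
  define g :: "rat poly" where "g = (\<Prod>j = 1..d. [:1, - of_nat j:] ^ e j)"
  \<comment> \<open>Every factor has constant coefficient 1. With \<open>g\<close> nonzero, the
    product identity can be turned into a quotient of power series.\<close>
  have "g \<noteq> 0"
    by (simp add: g_def)
  then have "fps_of_poly g \<noteq> 0"
    using fps_of_poly_eq_iff[of g 0] by simp
  moreover have "hilbert_series * fps_of_poly g = fps_of_poly f"
    using fe unfolding g_def .
  ultimately have "hilbert_series = fps_of_poly f / fps_of_poly g"
    by (metis nonzero_mult_div_cancel_right)
  then show "\<exists>f (g :: rat poly) (e :: nat \<Rightarrow> nat). g = (\<Prod>j = 1..d. [:1, - of_nat j:] ^ e j) \<and>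
      hilbert_series = fps_of_poly f / fps_of_poly g"
    using g_def by blast
  show "\<exists>p :: rat poly. \<forall>\<^sub>F n in sequentially. of_nat (hilbert_fun n) = poly p (of_nat n)" if "d = 1"
    using eventually_poly_of_rational_gf[of hilbert_series] rational_hilbert_series that
    by (simp add: hilbert_series_def)
qed

end
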